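(* For any frame $L$, the space $\mathsf{pt}(L)$ is scattered if and only if every element of $L$ other than $1$ which is a meet of primes has an absolutely essential prime.
   Context: For a frame $L$, a prime is an element $p\neq 1$ such that $x\wedge y\leq p$ implies $x\leq p$ or $y\leq p$. $\mathsf{pt}(L)$ is the set of primes of $L$, topologized with open sets $\{p\in\mathsf{pt}(L): a\nleq p\}$, $a\in L$. A space is scattered if every nonempty subspace has an isolated point (isolated in that subspace). For $a\in L$ which is a meet of primes (equivalently, the meet of all primes above it), a prime $p$ is an absolutely essential prime of $a$ if $a\leq p$ and, for every $P\subseteq\mathsf{pt}(L)$, $a=\bigwedge P$ implies $p\in P$. *)

theory Defs
  imports "HOL-Analysis.Abstract_Topology"
begin

class frame = complete_lattice +
  assumes frame_distrib: "inf x (Sup A) = (SUP y\<in>A. inf x y)"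

definition pt :: "'a::frame set" where
  "pt = {p. p \<noteq> top \<and> (\<forall>x y. inf x y \<le> p \<longrightarrow> x \<le> p \<or> y \<le> p)}"

definition pt_topology :: "'a::frame topology" where
  "pt_topology = topology (\<lambda>U. \<exists>a. U = {p \<in> pt. \<not> a \<le> p})"

(* The sets {p : pt. ~ a <= p} are already closed under finite intersections and arbitrary
   unions, so they are exactly the open sets. *)
lemma openin_pt_topology:
  "openin (pt_topology :: 'a::frame topology) U \<longleftrightarrow> (\<exists>a. U = {p \<in> pt. \<not> a \<le> p})"
proof -
  have "istopology (\<lambda>U :: 'a set. \<exists>a. U = {p \<in> pt. \<not> a \<le> p})"
    unfolding istopology_def
  proof (intro conjI allI impI)
    fix S T :: "'a set"
    assume "\<exists>a. S = {p \<in> pt. \<not> a \<le> p}" "\<exists>b. T = {p \<in> pt. \<not> b \<le> p}"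
    then obtain a b where S: "S = {p \<in> pt. \<not> a \<le> p}" and T: "T = {p \<in> pt. \<not> b \<le> p}"
      by blast
    have "S \<inter> T = {p \<in> pt. \<not> inf a b \<le> p}"
      unfolding S T by (auto simp: pt_def intro: le_infI1 le_infI2)
    then show "\<exists>c. S \<inter> T = {p \<in> pt. \<not> c \<le> p}" ..
  next
    fix K :: "'a set set"
    assume "\<forall>U\<in>K. \<exists>a. U = {p \<in> pt. \<not> a \<le> p}"
    then obtain f where f: "\<And>U. U \<in> K \<Longrightarrow> U = {p \<in> pt. \<not> f U \<le> p}"
      by metis
    have "\<Union>K = {p \<in> pt. \<not> Sup (f ` K) \<le> p}"
      using f by (auto simp: Sup_le_iff)
    then show "\<exists>a. \<Union>K = {p \<in> pt. \<not> a \<le> p}" ..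
  qed
  then show ?thesis
    by (simp add: pt_topology_def)
qed

lemma topspace_pt_topology: "topspace (pt_topology :: 'a::frame topology) = pt"
proof -
  have "openin pt_topology (pt :: 'a set)"
    unfolding openin_pt_topology by (rule exI[of _ top]) (auto simp: pt_def top_unique)
  moreover have "U \<subseteq> pt" if "openin pt_topology U" for U :: "'a set"
    using that unfolding openin_pt_topology by auto
  ultimately show ?thesis
    by (auto simp: topspace_def)
qed

definition scattered_space :: "'a topology \<Rightarrow> bool" where
  "scattered_space X \<longleftrightarrow>
     (\<forall>S \<subseteq> topspace X. S \<noteq> {} \<longrightarrow> (\<exists>x\<in>S. openin (subtopology X S) {x}))"

definition meet_of_primes :: "'a::frame \<Rightarrow> bool" where
  "meet_of_primes a \<longleftrightarrow> (\<exists>P \<subseteq> pt. a = Inf P)"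

definition absolutely_essential_prime :: "'a::frame \<Rightarrow> 'a \<Rightarrow> bool" where
  "absolutely_essential_prime a p \<longleftrightarrow>
     p \<in> pt \<and> a \<le> p \<and> (\<forall>P \<subseteq> pt. a = Inf P \<longrightarrow> p \<in> P)"

end

theory Submission
  imports Defs
begin

text \<open>
  The closed sets of the spectrum are the sets \<open>V a = {p \<in> pt. a \<le> p}\<close>, and
  the closure of a set \<open>S\<close> of primes is \<open>V (Inf S)\<close>. A point \<open>x\<close> of \<open>S\<close> is isolated in \<open>S\<close>
  exactly when it lies outside the closure of the other points, that is, when
  \<open>Inf (S - {x}) \<le> x\<close> fails. On the other hand, a prime \<open>p\<close> above a meet of primes \<open>a\<close> is
  absolutely essential exactly when it cannot be dropped from the largest representation
  \<open>a = Inf (V a)\<close>, and this is the same condition with \<open>S = V a\<close>. So the absolutely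
  essential primes of \<open>a\<close> are the isolated points of \<open>V a\<close>
  (\<open>absolutely_essential_prime_iff_isolated\<close>).

  Since the proper meets of primes correspond to the nonempty closed sets, the theorem says that
  scatteredness may be tested on closed sets. This holds in every space, because an isolated
  point of the closure of \<open>S\<close> already belongs to \<open>S\<close>. Here the last fact is built into the
  definition: an absolutely essential prime of \<open>Inf S\<close> lies in \<open>S\<close>.
\<close>

lemma Inf_primes_above:
  assumes "meet_of_primes (a :: 'a::frame)"
  shows "Inf {p \<in> pt. a \<le> p} = a"
proof -
  obtain P where P: "P \<subseteq> pt" "a = Inf P"
    using assms by (auto simp: meet_of_primes_def)
  have "P \<subseteq> {p \<in> pt. a \<le> p}"
    using P by (auto intro: Inf_lower)
  then have "Inf {p \<in> pt. a \<le> p} \<le> a"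
    using P(2) Inf_superset_mono by blast
  then show ?thesis
    by (rule antisym) (rule Inf_greatest, simp)
qed

text \<open>
  If some basic open set, given by \<open>a\<close>, separates \<open>x\<close> from the rest of \<open>S\<close>, then \<open>a\<close> lies
  below every other point of \<open>S\<close>. Hence \<open>Inf (S - {x})\<close> is the largest candidate, and it
  gives the largest open set among them.
\<close>

lemma isolated_in_pt_iff:
  fixes S :: "'a::frame set"
  assumes "S \<subseteq> pt" "x \<in> S"
  shows "openin (subtopology pt_topology S) {x} \<longleftrightarrow> \<not> Inf (S - {x}) \<le> x"
proof
  assume "openin (subtopology pt_topology S) {x}"
  then obtain a where a: "{x} = {p \<in> pt. \<not> a \<le> p} \<inter> S"
    unfolding openin_subtopology openin_pt_topology by blast
  have "a \<le> Inf (S - {x})"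
    using a assms(1) by (blast intro: Inf_greatest)
  moreover have "\<not> a \<le> x"
    using a by blast
  ultimately show "\<not> Inf (S - {x}) \<le> x"
    using order_trans by blast
next
  assume "\<not> Inf (S - {x}) \<le> x"
  then have "{x} = {p \<in> pt. \<not> Inf (S - {x}) \<le> p} \<inter> S"
    using assms by (auto intro: Inf_lower)
  then show "openin (subtopology pt_topology S) {x}"
    unfolding openin_subtopology openin_pt_topology by blast
qed

text \<open>
  Removing \<open>p\<close> from the primes above \<open>a\<close> changes their meet precisely when the meet of the
  remaining ones is not already below \<open>p\<close>. It suffices to look at this one set: any other
  representation of \<open>a\<close> that avoids \<open>p\<close> consists of some of the remaining primes, so its meet
  is at least theirs.
\<close>

lemma absolutely_essential_prime_iff_isolated:
  fixes a :: "'a::frame"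
  assumes a: "meet_of_primes a"
  shows "absolutely_essential_prime a p \<longleftrightarrow>
    p \<in> pt \<and> a \<le> p \<and> openin (subtopology pt_topology {q \<in> pt. a \<le> q}) {p}"
    (is "_ \<longleftrightarrow> _ \<and> _ \<and> openin (subtopology _ ?V) _")
proof (cases "p \<in> ?V")
  case p: True
  have "absolutely_essential_prime a p \<longleftrightarrow> \<not> Inf (?V - {p}) \<le> p"
  proof
    assume ess: "absolutely_essential_prime a p"
    show "\<not> Inf (?V - {p}) \<le> p"
    proof
      assume le: "Inf (?V - {p}) \<le> p"
      have "?V = insert p (?V - {p})"
        using p by blast
      then have "a = inf p (Inf (?V - {p}))"
        using Inf_primes_above[OF a] Inf_insert by metis
      then have "a = Inf (?V - {p})"
        using le by (simp add: inf_absorb2)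
      moreover have "?V - {p} \<subseteq> pt"
        by blast
      ultimately have "p \<in> ?V - {p}"
        using ess unfolding absolutely_essential_prime_def by blast
      then show False
        by blast
    qed
  next
    assume nle: "\<not> Inf (?V - {p}) \<le> p"
    have "p \<in> P" if P: "P \<subseteq> pt" "a = Inf P" for P
    proof (rule ccontr)
      assume "p \<notin> P"
      then have "P \<subseteq> ?V - {p}"
        using P by (auto intro: Inf_lower)
      then have "Inf (?V - {p}) \<le> a"
        unfolding P(2) by (rule Inf_superset_mono)
      then show False
        using nle p order_trans by blast
    qed
    then show "absolutely_essential_prime a p"
      using p by (simp add: absolutely_essential_prime_def)
  qed
  moreover have "openin (subtopology pt_topology ?V) {p} \<longleftrightarrow> \<not> Inf (?V - {p}) \<le> p"
    using p by (intro isolated_in_pt_iff) blast+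
  ultimately show ?thesis
    using p by blast
next
  case False
  then show ?thesis
    by (auto simp: absolutely_essential_prime_def)
qed

theorem proposition5p26:
  shows "scattered_space (pt_topology :: 'a::frame topology) \<longleftrightarrow>
    (\<forall>a :: 'a. a \<noteq> top \<and> meet_of_primes a \<longrightarrow> (\<exists>p. absolutely_essential_prime a p))"
proof (intro iffI allI impI)
  fix a :: 'a
  assume scattered: "scattered_space (pt_topology :: 'a topology)"
    and a: "a \<noteq> top \<and> meet_of_primes a"
  let ?V = "{p \<in> pt. a \<le> p}"
  have "?V \<noteq> {}"
    using a Inf_primes_above[of a] by (metis Inf_empty)
  moreover have "?V \<subseteq> topspace pt_topology"
    by (auto simp: topspace_pt_topology)
  ultimately obtain p where "p \<in> ?V" "openin (subtopology pt_topology ?V) {p}"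
    using scattered unfolding scattered_space_def by meson
  then show "\<exists>p. absolutely_essential_prime a p"
    using a by (auto simp: absolutely_essential_prime_iff_isolated)
next
  assume essential: "\<forall>a :: 'a. a \<noteq> top \<and> meet_of_primes a \<longrightarrow>
    (\<exists>p. absolutely_essential_prime a p)"
  show "scattered_space (pt_topology :: 'a topology)"
    unfolding scattered_space_def topspace_pt_topology
  proof (intro allI impI)
    fix S :: "'a set"
    assume S: "S \<subseteq> pt" "S \<noteq> {}"
    let ?V = "{q \<in> pt. Inf S \<le> q}"
    have meet: "meet_of_primes (Inf S)"
      using S(1) by (auto simp: meet_of_primes_def)
    obtain q where "q \<in> S"
      using S(2) by blast
    then have "Inf S \<le> q" "q \<noteq> top"
      using S(1) by (auto simp: pt_def intro: Inf_lower)
    then have "Inf S \<noteq> top"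
      using top_unique by metis
    then obtain p where p: "absolutely_essential_prime (Inf S) p"
      using essential meet by blast
    then have "p \<in> S"
      using S(1) by (auto simp: absolutely_essential_prime_def)
    have "openin (subtopology pt_topology ?V) {p}"
      using p meet by (simp add: absolutely_essential_prime_iff_isolated)
    moreover have "S \<subseteq> ?V"
      using S(1) by (auto intro: Inf_lower)
    ultimately have "openin (subtopology pt_topology S) {p}"
      using \<open>p \<in> S\<close> unfolding openin_subtopology by blast
    then show "\<exists>x\<in>S. openin (subtopology pt_topology S) {x}"
      using \<open>p \<in> S\<close> by blast
  qed
qed

end
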